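(* Let $(X,d)$ be a compact metric space and let $F:X\to 2^X$ be a positively expansive set-valued map. If $F$ has the shadowing property, then $F$ also has the periodic shadowing property.
   Context: Here $\mathbb N=\{0,1,2,\dots\}$ and $2^X$ is the family of nonempty compact subsets of $X$. For $x\in X$ and $A\subset X$, $d(x,A)=\inf\{d(x,y): y\in A\}$. No continuity of $F$ is assumed. An orbit of $F$ is a sequence $\{x_i\}_{i\in\mathbb N}$ with $x_{i+1}\in F(x_i)$ for all $i$; it is an orbit of the point $x$ if $x_0=x$. A $\delta$-pseudo-orbit is a sequence $\{x_i\}_{i\in\mathbb N}$ with $d(x_{i+1},F(x_i))<\delta$ for all $i$. A sequence (orbit or pseudo-orbit) $\{x_i\}_{i\in\mathbb N}$ is periodic if there is an integer $m\ge 1$ with $x_{i+m}=x_i$ for all $i\in\mathbb N$. - Positively expansive: there is $\alpha>0$ such that for every pair of distinct points $x,y\in X$ and any orbits $\{x_n\}_{n\in\mathbb N}$, $\{y_n\}_{n\in\mathbb N}$ of $F$ with $x_0=x$ and $y_0=y$, there is $n\in\mathbb N$ with $d(x_n,y_n)>\alpha$. - Shadowing property: for every $\varepsilon>0$ there is $\delta>0$ such that for every $\delta$-pseudo-orbit $\{x_i\}_{i\in\mathbb N}$ there is an orbit $\{z_i\}_{i\in\mathbb N}$ with $d(z_i,x_i)<\varepsilon$ for all $i\in\mathbb N$. - Periodic shadowing property: for every $\varepsilon>0$ there is $\delta>0$ such that for every periodic $\delta$-pseudo-orbit $\{x_i\}_{i\in\mathbb N}$ there is a periodic orbit $\{z_i\}_{i\in\mathbb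 N}$ (not required to have the same period) with $d(z_i,x_i)<\varepsilon$ for all $i\in\mathbb N$. *)

theory Defs
  imports "HOL-Analysis.Analysis"
begin

definition compact_hyperspace :: "'a::metric_space set \<Rightarrow> 'a set set"
  where "compact_hyperspace X = {A. A \<subseteq> X \<and> A \<noteq> {} \<and> compact A}"

text \<open>
  The metric space is a carrier set \<open>X\<close> inside a type of class \<open>metric_space\<close>. Values of a
  set-valued map \<open>F\<close> outside \<open>X\<close> are irrelevant, so membership of sequences in \<open>X\<close> is explicit.
\<close>

definition orbit :: "'a::metric_space set \<Rightarrow> ('a \<Rightarrow> 'a set) \<Rightarrow> (nat \<Rightarrow> 'a) \<Rightarrow> bool"
  where "orbit X F x \<longleftrightarrow> (\<forall>i. x i \<in> X) \<and> (\<forall>i. x (Suc i) \<in> F (x i))"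

text \<open>The library's \<open>infdist x A\<close> is 0 for empty \<open>A\<close>; here it is used only for nonempty \<open>A\<close>.\<close>

definition pseudo_orbit ::
  "'a::metric_space set \<Rightarrow> ('a \<Rightarrow> 'a set) \<Rightarrow> real \<Rightarrow> (nat \<Rightarrow> 'a) \<Rightarrow> bool"
  where "pseudo_orbit X F \<delta> x \<longleftrightarrow>
    (\<forall>i. x i \<in> X) \<and> (\<forall>i. infdist (x (Suc i)) (F (x i)) < \<delta>)"

definition periodic_seq :: "(nat \<Rightarrow> 'a) \<Rightarrow> bool"
  where "periodic_seq x \<longleftrightarrow> (\<exists>m\<ge>1. \<forall>i. x (i + m) = x i)"

definition positively_expansive :: "'a::metric_space set \<Rightarrow> ('a \<Rightarrow> 'a set) \<Rightarrow> bool"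
  where "positively_expansive X F \<longleftrightarrow>
    (\<exists>\<alpha>>0. \<forall>x\<in>X. \<forall>y\<in>X. x \<noteq> y \<longrightarrow>
      (\<forall>u v. orbit X F u \<and> u 0 = x \<and> orbit X F v \<and> v 0 = y \<longrightarrow>
        (\<exists>n. dist (u n) (v n) > \<alpha>)))"

definition shadowing_property :: "'a::metric_space set \<Rightarrow> ('a \<Rightarrow> 'a set) \<Rightarrow> bool"
  where "shadowing_property X F \<longleftrightarrow>
    (\<forall>\<epsilon>>0. \<exists>\<delta>>0. \<forall>x. pseudo_orbit X F \<delta> x \<longrightarrow>
      (\<exists>z. orbit X F z \<and> (\<forall>i. dist (z i) (x i) < \<epsilon>)))"

definition periodic_shadowing_property :: "'a::metric_space set \<Rightarrow> ('a \<Rightarrow> 'a set) \<Rightarrow> bool"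
  where "periodic_shadowing_property X F \<longleftrightarrow>
    (\<forall>\<epsilon>>0. \<exists>\<delta>>0. \<forall>x. pseudo_orbit X F \<delta> x \<and> periodic_seq x \<longrightarrow>
      (\<exists>z. orbit X F z \<and> periodic_seq z \<and> (\<forall>i. dist (z i) (x i) < \<epsilon>)))"

end

(* A periodic pseudo-orbit x of period m is shadowed within half the expansivity constant by an
   orbit z, hence also by the m-shifted orbit. So z (j + i) and z (j + m + i) stay within the
   expansivity constant of each other for all i, which forces z (j + m) = z j. *)
theory Submission
  imports Defs
begin

text \<open>\<open>F\<close> is the same at every time, so tails of orbits are orbits. This lets
  expansivity, which compares orbits from index 0, be applied at any time \<open>j\<close>.\<close>

lemma orbit_shift:
  assumes "orbit X F z"
  shows "orbit X F (\<lambda>i. z (j + i))"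
  using assms by (simp add: orbit_def)

theorem theorem4p1:
  fixes X :: "'a::metric_space set" and F :: "'a \<Rightarrow> 'a set"
  assumes "compact X"
    and "F \<in> X \<rightarrow> compact_hyperspace X"
    and "positively_expansive X F"
    and "shadowing_property X F"
  shows "periodic_shadowing_property X F"
  unfolding periodic_shadowing_property_def
proof (intro allI impI)
  fix \<epsilon> :: real assume "\<epsilon> > 0"
  \<comment> \<open>Orbits lie in \<open>X\<close>, so the initial points \<open>u 0\<close> and
    \<open>v 0\<close> can stand for the points of \<open>X\<close> in the definition.\<close>
  obtain \<alpha> where "\<alpha> > 0" and expansive: "\<And>u v. orbit X F u \<Longrightarrow> orbit X F v \<Longrightarrow>
      u 0 \<noteq> v 0 \<Longrightarrow> \<exists>n. dist (u n) (v n) > \<alpha>"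
    using assms(3) unfolding positively_expansive_def orbit_def by metis
  \<comment> \<open>The bound \<epsilon> serves the conclusion; \<alpha> / 2 makes two shadowing
    errors add up to less than \<alpha>.\<close>
  have "min \<epsilon> (\<alpha> / 2) > 0"
    using \<open>\<epsilon> > 0\<close> \<open>\<alpha> > 0\<close> by simp
  then obtain \<delta> where "\<delta> > 0" and shadow: "\<And>x. pseudo_orbit X F \<delta> x \<Longrightarrow>
      \<exists>z. orbit X F z \<and> (\<forall>i. dist (z i) (x i) < min \<epsilon> (\<alpha> / 2))"
    using assms(4) unfolding shadowing_property_def by meson
  show "\<exists>\<delta>>0. \<forall>x. pseudo_orbit X F \<delta> x \<and> periodic_seq x \<longrightarrow>
      (\<exists>z. orbit X F z \<and> periodic_seq z \<and> (\<forall>i. dist (z i) (x i) < \<epsilon>))"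
  \<comment> \<open>The \<delta> from ordinary shadowing is kept: expansivity alone makes the
    shadowing orbit periodic.\<close>
  proof (intro exI[of _ \<delta>] conjI allI impI \<open>\<delta> > 0\<close>)
    fix x assume x: "pseudo_orbit X F \<delta> x \<and> periodic_seq x"
    then obtain z where z: "orbit X F z"
      and close: "\<And>i. dist (z i) (x i) < min \<epsilon> (\<alpha> / 2)"
      using shadow by blast
    obtain m where "m \<ge> 1" and per: "\<And>i. x (i + m) = x i"
      using x unfolding periodic_seq_def by blast
    have "z (j + m) = z j" for j
    proof (rule ccontr)
      assume "z (j + m) \<noteq> z j"
      then obtain n where n: "dist (z (j + m + n)) (z (j + n)) > \<alpha>"
        using expansive[OF orbit_shift[OF z, of "j + m"] orbit_shift[OF z, of j]] by auto
      have "x (j + m + n) = x (j + n)"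
        using per[of "j + n"] by (simp add: ac_simps)
      \<comment> \<open>Triangle inequality through the common point
        \<open>x (j + m + n) = x (j + n)\<close>.\<close>
      then have "dist (z (j + m + n)) (z (j + n)) < \<alpha> / 2 + \<alpha> / 2"
        using close[of "j + m + n"] close[of "j + n"] dist_triangle_half_l by fastforce
      with n show False by simp
    qed
    \<comment> \<open>The period \<open>m\<close> of \<open>x\<close> is also a period of
      \<open>z\<close>.\<close>
    then have "periodic_seq z"
      using \<open>m \<ge> 1\<close> unfolding periodic_seq_def by blast
    with z close show "\<exists>z. orbit X F z \<and> periodic_seq z \<and> (\<forall>i. dist (z i) (x i) < \<epsilon>)"
      by auto
  qed
qed

end
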